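(* Let $(X,\sigma,\tau)$ be a $2$-permutational solution. Then the permutations $U$ and $T$ of $X$ given by $U(x)=\sigma_x^{-1}(x)$ and $T(x)=\tau_x^{-1}(x)$ are automorphisms of $(X,\sigma,\tau)$.
   Context: A solution $(X,\sigma,\tau)$ means a non-degenerate set-theoretic solution of the Yang–Baxter equation: a set $X$ (of arbitrary cardinality) with maps $\sigma,\tau:X^2\to X$, written $\sigma_x(y)=\sigma(x,y)$ and $\tau_y(x)=\tau(x,y)$, such that all $\sigma_x,\tau_y$ are bijections of $X$ and $r(x,y)=(\sigma_x(y),\tau_y(x))$ satisfies the braid relation $(\mathrm{id}\times r)(r\times \mathrm{id})(\mathrm{id}\times r)=(r\times \mathrm{id})(\mathrm{id}\times r)(r\times \mathrm{id})$ on $X^3$. Composition of maps is $(fg)(x)=f(g(x))$. The solution is $2$-permutational if $\sigma_{\sigma_x(z)}=\sigma_{\sigma_y(z)}$, $\tau_{\tau_x(z)}=\tau_{\tau_y(z)}$, $\sigma_{\tau_x(z)}=\sigma_{\tau_y(z)}$, $\tau_{\sigma_x(z)}=\tau_{\sigma_y(z)}$ for all $x,y,z\in X$. An automorphism of $(X,\sigma,\tau)$ is a bijection $\Phi:X\to X$ with $\Phi\sigma_x=\sigma_{\Phi(x)}\Phi$ and $\Phi\tau_x=\tau_{\Phi(x)}\Phi$ for all $x\in X$. *)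

theory Defs
  imports Main
begin

text \<open>
  A pair of maps on a carrier \<open>X\<close> is given by two indexed families: \<open>\<sigma> x\<close> is the map
  $\sigma_x$ and \<open>\<tau> y\<close> is the map $\tau_y$.  Thus $\sigma(x,y) = \sigma_x(y)$ is \<open>\<sigma> x y\<close>,
  whereas $\tau(x,y) = \tau_y(x)$ is \<open>\<tau> y x\<close>.  Since HOL functions are total, equality of
  maps on \<open>X\<close> is stated pointwise on \<open>X\<close>; values outside \<open>X\<close> are irrelevant.
\<close>

definition yb_map :: "('a \<Rightarrow> 'a \<Rightarrow> 'a) \<Rightarrow> ('a \<Rightarrow> 'a \<Rightarrow> 'a) \<Rightarrow> 'a \<times> 'a \<Rightarrow> 'a \<times> 'a" where
  "yb_map \<sigma> \<tau> = (\<lambda>(x, y). (\<sigma> x y, \<tau> y x))"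

text \<open>The maps $r \times \mathrm{id}$ and $\mathrm{id} \times r$ on triples.\<close>

definition times_id :: "('a \<times> 'a \<Rightarrow> 'a \<times> 'a) \<Rightarrow> 'a \<times> 'a \<times> 'a \<Rightarrow> 'a \<times> 'a \<times> 'a" where
  "times_id r = (\<lambda>(x, y, z). case r (x, y) of (u, v) \<Rightarrow> (u, v, z))"

definition id_times :: "('a \<times> 'a \<Rightarrow> 'a \<times> 'a) \<Rightarrow> 'a \<times> 'a \<times> 'a \<Rightarrow> 'a \<times> 'a \<times> 'a" where
  "id_times r = (\<lambda>(x, y, z). case r (y, z) of (u, v) \<Rightarrow> (x, u, v))"

definition braid_relation :: "'a set \<Rightarrow> ('a \<times> 'a \<Rightarrow> 'a \<times> 'a) \<Rightarrow> bool" where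
  "braid_relation X r \<longleftrightarrow>
     (\<forall>t \<in> X \<times> X \<times> X.
        (id_times r \<circ> times_id r \<circ> id_times r) t = (times_id r \<circ> id_times r \<circ> times_id r) t)"

text \<open>Non-degenerate set-theoretic solutions of the Yang--Baxter equation.\<close>

definition yb_solution :: "'a set \<Rightarrow> ('a \<Rightarrow> 'a \<Rightarrow> 'a) \<Rightarrow> ('a \<Rightarrow> 'a \<Rightarrow> 'a) \<Rightarrow> bool" where
  "yb_solution X \<sigma> \<tau> \<longleftrightarrow>
     (\<forall>x\<in>X. bij_betw (\<sigma> x) X X) \<and>
     (\<forall>y\<in>X. bij_betw (\<tau> y) X X) \<and>
     braid_relation X (yb_map \<sigma> \<tau>)"

definition maps_eq_on :: "'a set \<Rightarrow> ('a \<Rightarrow> 'a) \<Rightarrow> ('a \<Rightarrow> 'a) \<Rightarrow> bool" where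
  "maps_eq_on X f g \<longleftrightarrow> (\<forall>w\<in>X. f w = g w)"

definition two_permutational :: "'a set \<Rightarrow> ('a \<Rightarrow> 'a \<Rightarrow> 'a) \<Rightarrow> ('a \<Rightarrow> 'a \<Rightarrow> 'a) \<Rightarrow> bool" where
  "two_permutational X \<sigma> \<tau> \<longleftrightarrow>
     (\<forall>x\<in>X. \<forall>y\<in>X. \<forall>z\<in>X.
        maps_eq_on X (\<sigma> (\<sigma> x z)) (\<sigma> (\<sigma> y z)) \<and>
        maps_eq_on X (\<tau> (\<tau> x z)) (\<tau> (\<tau> y z)) \<and>
        maps_eq_on X (\<sigma> (\<tau> x z)) (\<sigma> (\<tau> y z)) \<and>
        maps_eq_on X (\<tau> (\<sigma> x z)) (\<tau> (\<sigma> y z)))"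

definition yb_automorphism ::
  "'a set \<Rightarrow> ('a \<Rightarrow> 'a \<Rightarrow> 'a) \<Rightarrow> ('a \<Rightarrow> 'a \<Rightarrow> 'a) \<Rightarrow> ('a \<Rightarrow> 'a) \<Rightarrow> bool" where
  "yb_automorphism X \<sigma> \<tau> \<Phi> \<longleftrightarrow>
     bij_betw \<Phi> X X \<and>
     (\<forall>x\<in>X. maps_eq_on X (\<Phi> \<circ> \<sigma> x) (\<sigma> (\<Phi> x) \<circ> \<Phi>)) \<and>
     (\<forall>x\<in>X. maps_eq_on X (\<Phi> \<circ> \<tau> x) (\<tau> (\<Phi> x) \<circ> \<Phi>))"

text \<open>For a family \<open>f\<close> of permutations of \<open>X\<close>, the map $x \mapsto f_x^{-1}(x)$; this is $U$ for
  \<open>f = \<sigma>\<close> and $T$ for \<open>f = \<tau>\<close>.\<close>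

definition diag_inv :: "'a set \<Rightarrow> ('a \<Rightarrow> 'a \<Rightarrow> 'a) \<Rightarrow> 'a \<Rightarrow> 'a" where
  "diag_inv X f x = inv_into X (f x) x"

end

theory Submission
  imports Defs
begin

text \<open>
  For a 2-permutational solution the maps $\sigma_{\sigma_x(z)}$ and $\tau_{\sigma_x(z)}$ depend only
  on $z$, and so do $\sigma_{\tau_x(z)}$ and $\tau_{\tau_x(z)}$; write $A_z = \sigma_{\sigma_x(z)}$,
  $B_z = \sigma_{\tau_x(z)}$ and $D_z = \tau_{\sigma_x(z)}$.  The first two components of the braid
  relation then say that $\sigma_x\sigma_z = A_z B_x$ and $D_z\sigma_x = B_x\tau_z$.

  The element $u = U(x)$ is characterised by $\sigma_x(u) = x$.  This gives $A_u = \sigma_x$ and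
  $D_u = \tau_x$, so $x = A_u(u)$: the map $u \mapsto A_u(u)$ is inverse to $U$.  It also gives
  $\sigma_x\sigma_u = A_u B_x = \sigma_x B_x$, hence $\sigma_{U(x)} = B_x$.  Therefore
  $\sigma_{U(x)}U(y) = B_x\sigma_y^{-1}(y) = A_y^{-1}\sigma_x(y) = U(\sigma_x(y))$.  The relation
  $D_u\sigma_y = B_y\tau_u$, with $D_u = \tau_x$, similarly gives
  $\tau_{U(x)}U(y) = B_y^{-1}\tau_x(y) = U(\tau_x(y))$.

  The hypotheses are symmetric under exchanging $\sigma$ and $\tau$, which turns $U$ into $T$, so the
  claim for $T$ is the claim for $U$ applied to the exchanged pair.
\<close>

lemma braid_relation_yb_map_iff:
  "braid_relation X (yb_map \<sigma> \<tau>) \<longleftrightarrow>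
     (\<forall>x\<in>X. \<forall>y\<in>X. \<forall>z\<in>X.
        \<sigma> x (\<sigma> y z) = \<sigma> (\<sigma> x y) (\<sigma> (\<tau> y x) z) \<and>
        \<sigma> (\<tau> (\<sigma> y z) x) (\<tau> z y) = \<tau> (\<sigma> (\<tau> y x) z) (\<sigma> x y) \<and>
        \<tau> (\<tau> z y) (\<tau> (\<sigma> y z) x) = \<tau> z (\<tau> y x))"
  unfolding braid_relation_def yb_map_def times_id_def id_times_def
  by auto

text \<open>
  Conjugating $r$ by the flip exchanges $\sigma$ and $\tau$; on triples it reverses the order of the
  factors, so it swaps the two sides of the braid relation.
\<close>

lemma yb_solution_swap:
  assumes "yb_solution X \<sigma> \<tau>"
  shows "yb_solution X \<tau> \<sigma>"
proof -
  have "braid_relation X (yb_map \<tau> \<sigma>)"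
    using assms unfolding yb_solution_def braid_relation_yb_map_iff by metis
  then show ?thesis
    using assms unfolding yb_solution_def by blast
qed

lemma two_permutational_swap:
  assumes "two_permutational X \<sigma> \<tau>"
  shows "two_permutational X \<tau> \<sigma>"
  using assms unfolding two_permutational_def by blast

lemma diag_inv_in:
  assumes "bij_betw (f x) X X" and "x \<in> X"
  shows "diag_inv X f x \<in> X"
  using assms unfolding diag_inv_def by (metis bij_betw_imp_surj_on inv_into_into)

lemma apply_diag_inv:
  assumes "bij_betw (f x) X X" and "x \<in> X"
  shows "f x (diag_inv X f x) = x"
  using assms unfolding diag_inv_def by (simp add: bij_betw_inv_into_right)

lemma diag_inv_eqI:
  assumes "bij_betw (f x) X X" and "u \<in> X" and "f x u = x"
  shows "diag_inv X f x = u"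
  using assms unfolding diag_inv_def by (metis bij_betw_inv_into_left)

lemma yb_automorphism_diag_inv:
  assumes sol: "yb_solution X \<sigma> \<tau>"
    and perm: "two_permutational X \<sigma> \<tau>"
  shows "yb_automorphism X \<sigma> \<tau> (diag_inv X \<sigma>)"
proof -
  let ?U = "diag_inv X \<sigma>"
  have bs: "bij_betw (\<sigma> x) X X" and bt: "bij_betw (\<tau> x) X X" if "x \<in> X" for x
    using sol that unfolding yb_solution_def by auto
  have sX: "\<sigma> x y \<in> X" and tX: "\<tau> x y \<in> X" if "x \<in> X" "y \<in> X" for x y
    using bs bt that by (auto dest: bij_betwE)
  have inj: "y = z" if "\<sigma> x y = \<sigma> x z" "x \<in> X" "y \<in> X" "z \<in> X" for x y z
    using bs that by (meson bij_betw_imp_inj_on inj_onD)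
  have braid1: "\<sigma> (\<sigma> x y) (\<sigma> (\<tau> y x) z) = \<sigma> x (\<sigma> y z)"
    and braid2: "\<sigma> (\<tau> (\<sigma> y z) x) (\<tau> z y) = \<tau> (\<sigma> (\<tau> y x) z) (\<sigma> x y)"
    if "x \<in> X" "y \<in> X" "z \<in> X" for x y z
    using sol that unfolding yb_solution_def braid_relation_yb_map_iff by auto
  have A: "\<sigma> (\<sigma> x z) w = \<sigma> (\<sigma> y z) w"
    and B: "\<sigma> (\<tau> x z) w = \<sigma> (\<tau> y z) w"
    and D: "\<tau> (\<sigma> x z) w = \<tau> (\<sigma> y z) w"
    if "x \<in> X" "y \<in> X" "z \<in> X" "w \<in> X" for x y z w
    using perm that unfolding two_permutational_def maps_eq_on_def by blast+
  have UX: "?U x \<in> X" and U: "\<sigma> x (?U x) = x" if "x \<in> X" for x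
    using bs[OF that] that by (auto intro: diag_inv_in apply_diag_inv)

  have "bij_betw ?U X X"
  proof (rule bij_betw_byWitness[where f' = "\<lambda>u. \<sigma> (\<sigma> u u) u"])
    have "\<sigma> (\<sigma> (?U x) (?U x)) (?U x) = \<sigma> (\<sigma> x (?U x)) (?U x)" if "x \<in> X" for x
      using A that UX by blast
    then show "\<forall>x\<in>X. \<sigma> (\<sigma> (?U x) (?U x)) (?U x) = x"
      using U by simp
    have "\<sigma> (\<sigma> (\<sigma> u u) u) u = \<sigma> (\<sigma> u u) u" if "u \<in> X" for u
      using A that sX by blast
    then show "\<forall>u\<in>X. ?U (\<sigma> (\<sigma> u u) u) = u"
      by (auto intro: diag_inv_eqI bs sX)
    show "?U ` X \<subseteq> X" "(\<lambda>u. \<sigma> (\<sigma> u u) u) ` X \<subseteq> X"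
      using UX sX by auto
  qed
  moreover have "?U (\<sigma> x y) = \<sigma> (?U x) (?U y)" if x: "x \<in> X" and y: "y \<in> X" for x y
  proof (rule diag_inv_eqI)
    \<comment> \<open>Cancelling $\sigma_x$ here gives $\sigma_{U(x)} = B_x$.\<close>
    have "\<sigma> x (\<sigma> (?U x) (?U y)) = \<sigma> x (\<sigma> (\<tau> (?U x) x) (?U y))"
      using braid1[OF x UX[OF x] UX[OF y]] U[OF x] by simp
    then have "\<sigma> (?U x) (?U y) = \<sigma> (\<tau> (?U x) x) (?U y)"
      by (rule inj) (simp_all add: x y UX sX tX)
    also have "\<dots> = \<sigma> (\<tau> y x) (?U y)"
      by (rule B) (simp_all add: x y UX)
    finally have "\<sigma> (?U x) (?U y) = \<sigma> (\<tau> y x) (?U y)" .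
    then show "\<sigma> (\<sigma> x y) (\<sigma> (?U x) (?U y)) = \<sigma> x y"
      using braid1[OF x y UX[OF y]] U[OF y] by simp
  qed (use x y bs sX UX in auto)
  moreover have "?U (\<tau> x y) = \<tau> (?U x) (?U y)" if x: "x \<in> X" and y: "y \<in> X" for x y
  proof (rule diag_inv_eqI)
    \<comment> \<open>The relation $B_y\tau_{U(x)} = D_{U(x)}\sigma_y$ evaluated at $U(y)$.\<close>
    have "\<sigma> (\<tau> x y) (\<tau> (?U x) (?U y)) = \<sigma> (\<tau> (\<sigma> (?U y) (?U x)) y) (\<tau> (?U x) (?U y))"
      by (rule B) (simp_all add: x y UX sX tX)
    also have "\<dots> = \<tau> (\<sigma> (\<tau> (?U y) y) (?U x)) (\<sigma> y (?U y))"
      by (rule braid2) (simp_all add: x y UX)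
    also have "\<dots> = \<tau> (\<sigma> x (?U x)) y"
      unfolding U[OF y] by (rule D) (simp_all add: x y UX tX)
    finally show "\<sigma> (\<tau> x y) (\<tau> (?U x) (?U y)) = \<tau> x y"
      using U[OF x] by simp
  qed (use x y bs tX UX in auto)
  ultimately show ?thesis
    unfolding yb_automorphism_def maps_eq_on_def by simp
qed

theorem lemma5p2:
  fixes X :: "'a set" and \<sigma> \<tau> :: "'a \<Rightarrow> 'a \<Rightarrow> 'a"
  assumes "yb_solution X \<sigma> \<tau>"
    and "two_permutational X \<sigma> \<tau>"
  shows "yb_automorphism X \<sigma> \<tau> (diag_inv X \<sigma>) \<and>
         yb_automorphism X \<sigma> \<tau> (diag_inv X \<tau>)"
proof
  show "yb_automorphism X \<sigma> \<tau> (diag_inv X \<sigma>)"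
    using assms by (rule yb_automorphism_diag_inv)
  have "yb_automorphism X \<tau> \<sigma> (diag_inv X \<tau>)"
    using yb_solution_swap[OF assms(1)] two_permutational_swap[OF assms(2)]
    by (rule yb_automorphism_diag_inv)
  then show "yb_automorphism X \<sigma> \<tau> (diag_inv X \<tau>)"
    unfolding yb_automorphism_def by simp
qed

end
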